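(* Let $n$ be a positive integer. Then there is a one-to-one correspondence (bijection) between the set of all one seat to full cinema mappings with $n$ seats and the set of non-singleton conquester chains of the poset $([n],\mid)$.
   Context: For a positive integer $n$, $[n]=\{1,\dots,n\}$, and $([n],\mid)$ is the poset $[n]$ ordered by divisibility. Cinema problem: a cinema has seats $1,\dots,n$ and people with tickets $1,\dots,n$ enter in this order; person $i$ may choose any unoccupied seat whose number is a multiple of $i$, and leaves only if all those seats are already occupied by previous people. Formally, a cinema mapping with $n$ seats is an injective map $\sigma:D_\sigma\to R_\sigma$, where $D_\sigma\subseteq[n]$ and $R_\sigma=\sigma(D_\sigma)\subseteq[n]$, such that: (divisor-first) if $i\mid j$ and $j\in D_\sigma$ then $i\in D_\sigma$; (seat-multiple-ticket) $i\mid\sigma(i)$ for each $i\in D_\sigma$; and (exit rule) if $i\in[n]\setminus D_\sigma$ then every multiple of $i$ in $[n]$ equals $\sigma(j)$ for some $j\in D_\sigma$ with $j<i$. A cinema mapping $\sigma$ with $n$ seats is called one seat to full if $|D_\sigma|=n-1$. A chain $C=\{a_1\prec\cdots\prec a_k\}$ ($k\ge 1$) in a finite poset $(\mathsf P,\preceq)$ is called a conquester chain if its largest element $a_k$ is a maximal element of $\mathsf P$; it is non-singleton if $k\geq 2$. *)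

theory Defs
  imports Main
begin

text \<open>A map \<open>\<sigma> : D \<rightarrow> R\<close> with \<open>D \<subseteq> [n]\<close> and \<open>R = \<sigma>(D) \<subseteq> [n]\<close> is encoded as a partial function
  with \<open>dom \<sigma> = D\<close> and \<open>ran \<sigma> = R\<close>, so that distinct mappings are distinct objects.\<close>

definition cinema_mapping :: "nat \<Rightarrow> (nat \<rightharpoonup> nat) \<Rightarrow> bool" where
  "cinema_mapping n \<sigma> \<longleftrightarrow>
     dom \<sigma> \<subseteq> {1..n} \<and> ran \<sigma> \<subseteq> {1..n} \<and> inj_on \<sigma> (dom \<sigma>) \<and>
     (\<forall>i j. i dvd j \<and> j \<in> dom \<sigma> \<longrightarrow> i \<in> dom \<sigma>) \<and>
     (\<forall>i\<in>dom \<sigma>. i dvd the (\<sigma> i)) \<and>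
     (\<forall>i\<in>{1..n} - dom \<sigma>. \<forall>m\<in>{1..n}. i dvd m \<longrightarrow> (\<exists>j\<in>dom \<sigma>. j < i \<and> \<sigma> j = Some m))"

definition one_seat_to_full :: "nat \<Rightarrow> (nat \<rightharpoonup> nat) \<Rightarrow> bool" where
  "one_seat_to_full n \<sigma> \<longleftrightarrow> cinema_mapping n \<sigma> \<and> card (dom \<sigma>) = n - 1"

text \<open>A poset is given by its reflexive order relation \<open>r\<close>, with carrier \<open>Field r\<close>.\<close>

definition maximal_element :: "'a rel \<Rightarrow> 'a \<Rightarrow> bool" where
  "maximal_element r a \<longleftrightarrow> a \<in> Field r \<and> (\<forall>b. (a, b) \<in> r \<longrightarrow> b = a)"

definition conquester_chain :: "'a rel \<Rightarrow> 'a set \<Rightarrow> bool" where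
  "conquester_chain r C \<longleftrightarrow>
     finite C \<and> C \<in> Chains r \<and>
     (\<exists>a\<in>C. (\<forall>b\<in>C. (b, a) \<in> r) \<and> maximal_element r a)"

definition non_singleton_conquester_chain :: "'a rel \<Rightarrow> 'a set \<Rightarrow> bool" where
  "non_singleton_conquester_chain r C \<longleftrightarrow> conquester_chain r C \<and> card C \<ge> 2"

definition divisibility_order :: "nat \<Rightarrow> nat rel" where
  "divisibility_order n = {(a, b). a \<in> {1..n} \<and> b \<in> {1..n} \<and> a dvd b}"

lemma Field_divisibility_order: "Field (divisibility_order n) = {1..n}"
  by (auto simp: divisibility_order_def Field_def)

lemma partial_order_on_divisibility_order:
  "partial_order_on {1..n} (divisibility_order n)"
  by (auto simp: divisibility_order_def partial_order_on_def preorder_on_def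
      refl_on_def trans_def antisym_def intro: dvd_trans dvd_antisym)

end

theory Submission imports Defs begin

text \<open>View a cinema mapping \<open>\<sigma>\<close> as a functional graph on the seats. Every arrow goes from \<open>i\<close> to a
  multiple of \<open>i\<close>, so \<open>\<sigma>\<close> is the identity or increasing at each point. If a single person \<open>p\<close> gets no
  seat, the people who do not sit on their own seat, together with \<open>p\<close>, form one increasing path that
  ends in \<open>p\<close>: injectivity leaves no room for branching, and the increasing arrows exclude cycles.
  Along the path each ticket divides the next one, so the path is a chain. The divisor-first condition
  says that \<open>p\<close> has no proper multiple in \<open>[n]\<close>, and the exit rule at seat \<open>p\<close> says that somebody else
  sits there, so the chain has at least two elements.

  Conversely a non-singleton conquester chain is turned into a mapping by moving each of its elements
  below the top one step up the chain, giving the top no seat and fixing everybody else. Hence the bijection sends \<open>\<sigma>\<close> to its set of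
  non-fixed points, and \<open>shift_along\<close> is its inverse. That \<open>\<sigma>\<close> can be recovered from its
  non-fixed points alone rests on \<open>increasing_injection_is_next\<close>: an increasing injection
  of a finite set of numbers without its maximum into that set can only be the successor function.\<close>

section \<open>Increasing injections of finite sets of numbers\<close>

definition next_in :: "nat set \<Rightarrow> nat \<Rightarrow> nat" where
  "next_in C i = Min {c \<in> C. i < c}"

lemma next_in:
  assumes "finite C" "i \<in> C" "i \<noteq> Max C"
  shows "next_in C i \<in> C" "i < next_in C i" "\<And>c. c \<in> C \<Longrightarrow> i < c \<Longrightarrow> next_in C i \<le> c"
proof -
  have "Max C \<in> C" using assms by (intro Max_in) auto
  moreover have "i \<le> Max C" using assms by simp
  ultimately have "Max C \<in> {c \<in> C. i < c}" using assms(3) by simp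
  then have "Min {c \<in> C. i < c} \<in> {c \<in> C. i < c}"
    using assms by (intro Min_in) auto
  then show "next_in C i \<in> C" "i < next_in C i" by (auto simp: next_in_def)
  show "\<And>c. c \<in> C \<Longrightarrow> i < c \<Longrightarrow> next_in C i \<le> c"
    using assms by (auto simp: next_in_def)
qed

text \<open>For non-maximal \<open>i\<close>, the function maps the non-maximal elements from \<open>i\<close> upwards into the elements
  strictly above \<open>i\<close>. The two sets have the same size, so the map is onto. In particular the successor
  of \<open>i\<close> is a value, and only \<open>i\<close> itself is small enough to attain it.\<close>

lemma increasing_injection_is_next:
  fixes C :: "nat set"
  assumes fin: "finite C" and inj: "inj_on f (C - {Max C})"
    and into: "\<And>i. i \<in> C - {Max C} \<Longrightarrow> f i \<in> C"
    and incr: "\<And>i. i \<in> C - {Max C} \<Longrightarrow> i < f i"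
    and i: "i \<in> C" "i \<noteq> Max C"
  shows "f i = next_in C i"
proof -
  let ?A = "{c \<in> C. i \<le> c} - {Max C}" and ?B = "{c \<in> C. i < c}"
  have M: "Max C \<in> C" "i \<le> Max C" using fin i by (auto intro: Max_in)
  have "{c \<in> C. i \<le> c} = insert i ?B" using i by auto
  then have "card {c \<in> C. i \<le> c} = Suc (card ?B)" using fin by simp
  then have card: "card ?A = card ?B" using M fin by simp
  have sub: "f ` ?A \<subseteq> ?B"
  proof
    fix y assume "y \<in> f ` ?A"
    then obtain c where "c \<in> C - {Max C}" "i \<le> c" "y = f c" by blast
    then show "y \<in> ?B" using into[of c] incr[of c] by auto
  qed
  have "inj_on f ?A" using inj by (rule inj_on_subset) auto
  then have "card (f ` ?A) = card ?B" using card by (simp add: card_image)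
  then have onto: "f ` ?A = ?B" using sub fin by (intro card_subset_eq) auto
  have "next_in C i \<in> ?B" using next_in[OF fin i] by auto
  then have "next_in C i \<in> f ` ?A" by (simp only: onto)
  then obtain c where "c \<in> ?A" "next_in C i = f c" by blast
  then have c: "c \<in> C - {Max C}" "i \<le> c" "f c = next_in C i" by simp_all
  have "\<not> i < c"
  proof
    assume "i < c"
    then have "f c \<le> c" using next_in(3)[OF fin i, of c] c by simp
    then show False using incr[OF c(1)] by simp
  qed
  then have "i = c" using c(2) by simp
  then show ?thesis using c(3) by simp
qed

section \<open>Conquester chains of numbers\<close>

text \<open>For a set of positive numbers, being a chain for divisibility means that the usual order of its
  elements is also their divisibility order; the top of the chain is then its numerical maximum.\<close>

lemma non_singleton_conquester_chain_iff:
  "non_singleton_conquester_chain (divisibility_order n) C \<longleftrightarrow>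
     C \<subseteq> {1..n} \<and> 2 \<le> card C \<and> (\<forall>i\<in>C. \<forall>j\<in>C. i \<le> j \<longrightarrow> i dvd j) \<and>
     (\<forall>b\<in>{1..n}. Max C dvd b \<longrightarrow> b = Max C)" (is "?L \<longleftrightarrow> ?R")
proof
  assume ?L
  then obtain a where fin: "finite C" and ch: "C \<in> Chains (divisibility_order n)"
    and card: "2 \<le> card C" and a: "a \<in> C" "\<forall>b\<in>C. (b, a) \<in> divisibility_order n"
    and max: "maximal_element (divisibility_order n) a"
    by (auto simp: non_singleton_conquester_chain_def conquester_chain_def)
  have sub: "C \<subseteq> {1..n}" using a by (auto simp: divisibility_order_def)
  have "Max C = a"
    using fin a by (intro Max_eqI) (auto simp: divisibility_order_def dvd_imp_le)
  moreover have "i dvd j" if "i \<in> C" "j \<in> C" "i \<le> j" for i j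
  proof -
    have "i dvd j \<or> j dvd i"
      using ch that by (auto simp: Chains_def divisibility_order_def)
    moreover have "0 < i" using sub that by auto
    ultimately show ?thesis using that dvd_imp_le[of j i] by auto
  qed
  moreover have "a \<in> {1..n}" using sub a by auto
  ultimately show ?R
    using sub card max by (auto simp: maximal_element_def divisibility_order_def)
next
  assume R: ?R
  then have fin: "finite C" by (auto intro: finite_subset)
  have M: "Max C \<in> C" using R fin by (intro Max_in) auto
  have "C \<in> Chains (divisibility_order n)"
  proof -
    have "(i, j) \<in> divisibility_order n \<or> (j, i) \<in> divisibility_order n"
      if "i \<in> C" "j \<in> C" for i j
      using R that by (cases "i \<le> j") (auto simp: divisibility_order_def)
    then show ?thesis by (auto simp: Chains_def)
  qed
  moreover have "\<forall>b\<in>C. (b, Max C) \<in> divisibility_order n"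
    using R M fin by (auto simp: divisibility_order_def)
  moreover have "maximal_element (divisibility_order n) (Max C)"
    using R M unfolding maximal_element_def Field_divisibility_order
    by (auto simp: divisibility_order_def)
  ultimately show ?L
    using R fin M by (auto simp: non_singleton_conquester_chain_def conquester_chain_def)
qed

section \<open>The chain of displaced people\<close>

text \<open>A person in \<open>[n]\<close> without a seat counts as displaced, since \<open>None\<close> differs from \<open>Some i\<close>;
  this is what puts the top of the chain into the set.\<close>

definition displaced :: "nat \<Rightarrow> (nat \<rightharpoonup> nat) \<Rightarrow> nat set" where
  "displaced n \<sigma> = {i \<in> {1..n}. \<sigma> i \<noteq> Some i}"

lemma one_seat_to_fullE:
  assumes \<sigma>: "one_seat_to_full n \<sigma>" and n: "0 < n"
  obtains p where "p \<in> {1..n}" "dom \<sigma> = {1..n} - {p}"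
proof -
  have D: "dom \<sigma> \<subseteq> {1..n}" "card (dom \<sigma>) = n - 1"
    using \<sigma> by (auto simp: one_seat_to_full_def cinema_mapping_def)
  then have "card ({1..n} - dom \<sigma>) = 1"
    using n by (subst card_Diff_subset) (auto intro: finite_subset)
  then obtain p where "{1..n} - dom \<sigma> = {p}" by (auto simp: card_1_singleton_iff)
  then show thesis using D by (intro that[of p]) auto
qed

text \<open>The non-fixed points are closed under \<open>\<sigma>\<close>: if a displaced person sat on the seat of
  somebody who is not displaced, that seat would be taken twice. Each displaced person with a seat is
  moved strictly upwards, so the greatest displaced person is the one without a seat.\<close>

lemma displaced_structure:
  assumes \<sigma>: "one_seat_to_full n \<sigma>" and n: "0 < n"
  defines "C \<equiv> displaced n \<sigma>"
  shows "dom \<sigma> = {1..n} - {Max C}" "2 \<le> card C"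
    "\<And>i. i \<in> C \<Longrightarrow> i \<noteq> Max C \<Longrightarrow> \<sigma> i = Some (next_in C i)"
proof -
  obtain p where p: "p \<in> {1..n}" and dom: "dom \<sigma> = {1..n} - {p}"
    using \<sigma> n by (rule one_seat_to_fullE)
  have ran: "ran \<sigma> \<subseteq> {1..n}" and inj: "inj_on \<sigma> (dom \<sigma>)"
    and dvd: "\<And>i. i \<in> dom \<sigma> \<Longrightarrow> i dvd the (\<sigma> i)"
    and exit: "\<forall>i\<in>{1..n} - dom \<sigma>. \<forall>m\<in>{1..n}. i dvd m \<longrightarrow> (\<exists>j\<in>dom \<sigma>. j < i \<and> \<sigma> j = Some m)"
    using \<sigma> unfolding one_seat_to_full_def cinema_mapping_def by blast+
  have fin: "finite C" by (simp add: C_def displaced_def)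
  have pC: "p \<in> C" using p dom by (auto simp: C_def displaced_def)
  have step: "\<exists>j. \<sigma> i = Some j \<and> j \<in> C \<and> i < j" if i: "i \<in> C" "i \<noteq> p" for i
  proof -
    have id: "i \<in> dom \<sigma>" using i dom by (auto simp: C_def displaced_def)
    then obtain j where j: "\<sigma> i = Some j" by auto
    have ji: "j \<noteq> i" using i j by (auto simp: C_def displaced_def)
    have jn: "j \<in> {1..n}" using ran j by (auto intro: ranI)
    have "\<sigma> j \<noteq> Some j"
    proof
      assume "\<sigma> j = Some j"
      then show False using inj_onD[OF inj, of i j] j ji id by auto
    qed
    then have "j \<in> C" using jn by (auto simp: C_def displaced_def)
    moreover have "i \<le> j" using dvd[OF id] j jn by (auto intro: dvd_imp_le)
    ultimately show ?thesis using j ji by auto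
  qed
  have "Max C \<in> C" using fin pC by (intro Max_in) auto
  then have Mp: "Max C = p"
    using step[of "Max C"] Max_ge[OF fin] by (metis leD)
  then show "dom \<sigma> = {1..n} - {Max C}" using dom by simp
  have "p \<in> {1..n} - dom \<sigma>" using p dom by blast
  then have "\<exists>j\<in>dom \<sigma>. j < p \<and> \<sigma> j = Some p" using bspec[OF bspec[OF exit] p] by simp
  then obtain j where "j \<in> dom \<sigma>" "j < p" "\<sigma> j = Some p" by blast
  then have "j \<in> C" "card {j, p} = 2" using dom by (auto simp: C_def displaced_def)
  then have "{j, p} \<subseteq> C" "card {j, p} = 2" using pC by simp_all
  then show "2 \<le> card C" using card_mono[OF fin, of "{j, p}"] by simp
  fix i assume i: "i \<in> C" "i \<noteq> Max C"
  have CD: "C - {Max C} \<subseteq> dom \<sigma>" using dom Mp by (auto simp: C_def displaced_def)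
  have inj': "inj_on (\<lambda>i. the (\<sigma> i)) (C - {Max C})"
  proof (rule inj_onI)
    fix x y assume xy: "x \<in> C - {Max C}" "y \<in> C - {Max C}" "the (\<sigma> x) = the (\<sigma> y)"
    then have D: "x \<in> dom \<sigma>" "y \<in> dom \<sigma>" using CD by auto
    then have "\<sigma> x = \<sigma> y" using xy by auto
    then show "x = y" using inj D by (auto dest: inj_onD)
  qed
  have "the (\<sigma> i) = next_in C i"
  proof (rule increasing_injection_is_next[OF fin inj' _ _ i])
    show "the (\<sigma> k) \<in> C" "k < the (\<sigma> k)" if "k \<in> C - {Max C}" for k
      using step[of k] that Mp by auto
  qed
  then show "\<sigma> i = Some (next_in C i)" using i step[of i] Mp by auto
qed

text \<open>Each displaced ticket divides the next displaced ticket, because that is the seat it is moved to;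
  divisibility of any larger displaced ticket follows by climbing step by step. A proper multiple in
  \<open>[n]\<close> of the top would have a seat, so by the divisor-first condition the top would have one too.\<close>

lemma displaced_is_chain:
  assumes \<sigma>: "one_seat_to_full n \<sigma>" and n: "0 < n"
  shows "non_singleton_conquester_chain (divisibility_order n) (displaced n \<sigma>)"
proof -
  let ?C = "displaced n \<sigma>"
  note S = displaced_structure[OF \<sigma> n]
  have sub: "?C \<subseteq> {1..n}" by (auto simp: displaced_def)
  then have fin: "finite ?C" by (auto intro: finite_subset)
  have down: "\<And>i j. i dvd j \<Longrightarrow> j \<in> dom \<sigma> \<Longrightarrow> i \<in> dom \<sigma>"
    and dvd: "\<And>i. i \<in> dom \<sigma> \<Longrightarrow> i dvd the (\<sigma> i)"
    using \<sigma> unfolding one_seat_to_full_def cinema_mapping_def by blast+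
  have chain: "i dvd j" if "i \<in> ?C" "j \<in> ?C" "i \<le> j" for i j
    using that
  proof (induction "j - i" arbitrary: i rule: less_induct)
    case less
    show ?case
    proof (cases "i = j")
      case False
      then have ij: "i < j" using less.prems by simp
      then have iM: "i \<noteq> Max ?C" using Max_ge[OF fin less.prems(2)] by auto
      note N = next_in[OF fin less.prems(1) iM]
      have "i \<in> dom \<sigma>" using S(1) sub less.prems(1) iM by auto
      then have "i dvd next_in ?C i" using dvd[of i] S(3)[OF less.prems(1) iM] by simp
      moreover have "next_in ?C i dvd j"
        using less.hyps[of "next_in ?C i"] N less.prems(2) ij by fastforce
      ultimately show ?thesis by (rule dvd_trans)
    qed simp
  qed
  have "b = Max ?C" if "b \<in> {1..n}" "Max ?C dvd b" for b
    using down[OF that(2)] that(1) S(1) by auto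
  then show ?thesis
    using sub S(2) chain by (auto simp: non_singleton_conquester_chain_iff)
qed

section \<open>The mapping of a chain\<close>

definition shift_along :: "nat \<Rightarrow> nat set \<Rightarrow> (nat \<rightharpoonup> nat)" where
  "shift_along n C i =
     (if i \<in> {1..n} \<and> i \<noteq> Max C then Some (if i \<in> C then next_in C i else i) else None)"

text \<open>Only the top \<open>p\<close> of the chain loses its seat. As \<open>p\<close> is maximal, removing it leaves
  a set closed under divisors, and the only seat for \<open>p\<close> is \<open>p\<close>, which is taken by the
  element just below \<open>p\<close> in the chain.\<close>

lemma shift_along_one_seat_to_full:
  assumes C: "non_singleton_conquester_chain (divisibility_order n) C"
  shows "one_seat_to_full n (shift_along n C)"
proof -
  let ?\<sigma> = "shift_along n C"
  have sub: "C \<subseteq> {1..n}" and card: "2 \<le> card C"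
    and chain: "\<And>i j. i \<in> C \<Longrightarrow> j \<in> C \<Longrightarrow> i \<le> j \<Longrightarrow> i dvd j"
    and top: "\<And>b. b \<in> {1..n} \<Longrightarrow> Max C dvd b \<Longrightarrow> b = Max C"
    using C by (auto simp: non_singleton_conquester_chain_iff)
  have fin: "finite C" using sub by (auto intro: finite_subset)
  have M: "Max C \<in> C" using fin card by (intro Max_in) auto
  then have Mn: "Max C \<in> {1..n}" using sub by blast
  have dom: "dom ?\<sigma> = {1..n} - {Max C}"
    by (auto simp: shift_along_def split: if_splits)
  note N = next_in[OF fin]
  have ran: "ran ?\<sigma> \<subseteq> {1..n}"
  proof
    fix y assume "y \<in> ran ?\<sigma>"
    then obtain x where "?\<sigma> x = Some y" by (auto simp: ran_def)
    then show "y \<in> {1..n}"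
      using N(1)[of x] sub by (auto simp: shift_along_def split: if_splits)
  qed
  have inj: "inj_on ?\<sigma> (dom ?\<sigma>)"
  proof (rule inj_onI)
    fix x y assume D: "x \<in> dom ?\<sigma>" "y \<in> dom ?\<sigma>" and eq: "?\<sigma> x = ?\<sigma> y"
    have less: "next_in C i < next_in C j" if "i \<in> C" "j \<in> C" "j \<noteq> Max C" "i < j" for i j
    proof -
      have "i \<noteq> Max C" using Max_ge[OF fin that(2)] that(4) by auto
      then have "next_in C i \<le> j" using N(3)[OF that(1) _ that(2,4)] by simp
      then show ?thesis using N(2)[OF that(2,3)] by simp
    qed
    show "x = y"
      using D eq N(1)[of x] N(1)[of y] less[of x y] less[of y x] unfolding dom
      by (cases x y rule: linorder_cases) (auto simp: shift_along_def split: if_splits)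
  qed
  have down: "i \<in> dom ?\<sigma>" if "i dvd j" "j \<in> dom ?\<sigma>" for i j
  proof -
    have j: "j \<in> {1..n}" "j \<noteq> Max C" using that dom by auto
    then have "i \<noteq> Max C" using top that by blast
    moreover have "i \<noteq> 0" "i \<le> j" using that j by (auto intro: dvd_imp_le)
    ultimately show ?thesis using dom j by auto
  qed
  have dvd: "i dvd the (?\<sigma> i)" if "i \<in> dom ?\<sigma>" for i
    using that N[of i] chain[of i "next_in C i"] unfolding dom
    by (auto simp: shift_along_def)
  have exit: "\<exists>j\<in>dom ?\<sigma>. j < Max C \<and> ?\<sigma> j = Some (Max C)"
  proof -
    let ?j = "Max (C - {Max C})"
    have "card (C - {Max C}) \<noteq> 0" using card M fin by simp
    then have "C - {Max C} \<noteq> {}" by (metis card.empty)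
    then have "?j \<in> C - {Max C}" using fin by (intro Max_in) auto
    then have j: "?j \<in> C" "?j \<noteq> Max C" by auto
    have "next_in C ?j = Max C"
    proof (rule ccontr)
      assume "next_in C ?j \<noteq> Max C"
      then have "next_in C ?j \<le> ?j" using N(1)[OF j] fin by (intro Max_ge) auto
      then show False using N(2)[OF j] by simp
    qed
    moreover have "?j < Max C" using Max_ge[OF fin j(1)] j(2) by simp
    moreover have "?j \<in> {1..n}" using sub j(1) by blast
    ultimately show ?thesis using j dom by (intro bexI[of _ ?j]) (auto simp: shift_along_def)
  qed
  have "\<forall>i\<in>{1..n} - dom ?\<sigma>. \<forall>m\<in>{1..n}. i dvd m \<longrightarrow> (\<exists>j\<in>dom ?\<sigma>. j < i \<and> ?\<sigma> j = Some m)"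
    using exit top dom by blast
  moreover have "dom ?\<sigma> \<subseteq> {1..n}" using dom by blast
  moreover have "\<forall>i j. i dvd j \<and> j \<in> dom ?\<sigma> \<longrightarrow> i \<in> dom ?\<sigma>" using down by blast
  moreover have "\<forall>i\<in>dom ?\<sigma>. i dvd the (?\<sigma> i)" using dvd by blast
  ultimately have "cinema_mapping n ?\<sigma>"
    unfolding cinema_mapping_def using ran inj by (intro conjI)
  moreover have "card (dom ?\<sigma>) = n - 1" using dom Mn by simp
  ultimately show ?thesis by (simp add: one_seat_to_full_def)
qed

lemma displaced_shift_along:
  assumes "C \<subseteq> {1..n}" "C \<noteq> {}"
  shows "displaced n (shift_along n C) = C"
proof -
  have fin: "finite C" using assms by (auto intro: finite_subset)
  have M: "Max C \<in> C" using assms fin by (intro Max_in)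
  have "next_in C i \<noteq> i" if "i \<in> C" "i \<noteq> Max C" for i
    using next_in(2)[OF fin that] by simp
  then have "i \<in> displaced n (shift_along n C) \<longleftrightarrow> i \<in> {1..n} \<and> i \<in> C" for i
    using M by (auto simp: displaced_def shift_along_def)
  then show ?thesis using assms(1) by blast
qed

lemma shift_along_displaced:
  assumes \<sigma>: "one_seat_to_full n \<sigma>" and n: "0 < n"
  shows "shift_along n (displaced n \<sigma>) = \<sigma>"
proof
  fix i
  note S = displaced_structure[OF \<sigma> n]
  show "shift_along n (displaced n \<sigma>) i = \<sigma> i"
  proof (cases "i \<in> dom \<sigma>")
    case True
    then show ?thesis using S(1) S(3)[of i]
      by (cases "i \<in> displaced n \<sigma>") (auto simp: shift_along_def displaced_def)
  next
    case False
    then have "\<sigma> i = None" by auto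
    then show ?thesis using False S(1) by (auto simp: shift_along_def)
  qed
qed

theorem proposition4p3:
  fixes n :: nat
  assumes "n > 0"
  shows "\<exists>f. bij_betw f {\<sigma>. one_seat_to_full n \<sigma>}
           {C. non_singleton_conquester_chain (divisibility_order n) C}"
proof -
  have inverse: "displaced n (shift_along n C) = C"
    if "non_singleton_conquester_chain (divisibility_order n) C" for C
    using that by (intro displaced_shift_along) (auto simp: non_singleton_conquester_chain_iff)
  have "bij_betw (displaced n) {\<sigma>. one_seat_to_full n \<sigma>}
          {C. non_singleton_conquester_chain (divisibility_order n) C}"
    by (rule bij_betw_byWitness[where f' = "shift_along n"])
      (auto simp: inverse shift_along_displaced[OF _ assms] displaced_is_chain[OF _ assms]
        shift_along_one_seat_to_full)
  then show ?thesis by blast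
qed

end
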